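(* Let $x>1$ be an integer, let $s>1$ be real, and let $g$ be analytic in a set $A\supseteq(-1,1]$ with $g(0)=0$, such that the numbers $\frac{g^{(a)}(0)}{a!}$, $a=1,2,3,\dots$, are bounded above. Let $p_k$ denote the $k$-th prime. Then $$\sum_{n\le x}\frac{\mu(n)}{n}\sum_{k=1}^{\infty}\sum_{l=1}^{\infty}\frac1l\, g\!\left(\frac{1}{p_k^{snl}}\right)=\sum_{k=1}^{\infty} g\!\left(\frac{1}{p_k^{s}}\right)+O\!\left(x\cdot g\!\left(\frac{1}{2^{s(x+1)}}\right)\right),$$ where the implied constant does not depend on $x$.
   Context: $\mu$ is the Möbius function: $\mu(1)=1$, $\mu(k)=(-1)^r$ if $k$ is a product of $r$ distinct primes, $\mu(k)=0$ otherwise.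
   Formalization: The O-estimate is stated as x→∞ and, with one constant, for all x>1 with g(1/2^{s(x+1)})≠0; at an x where this value is 0 the claim can fail, e.g. g(z)=z−2^{3s}z² at x=2. Analytic is read as complex analytic, with real Taylor coefficients. *)

theory Defs
  imports "HOL-Complex_Analysis.Complex_Analysis" "HOL-Library.Landau_Symbols"
    "HOL-Computational_Algebra.Primes"
begin

text \<open>
  The condition says that \<open>n\<close> is a product of distinct primes; it holds for \<open>n = 1\<close>
  (empty product) and fails for \<open>n = 0\<close>.
\<close>

definition moebius_mu :: "nat \<Rightarrow> int" where
  "moebius_mu n = (if n = \<Prod>(prime_factors n) then (- 1) ^ card (prime_factors n) else 0)"

text \<open>One-based indexing, so \<open>kth_prime 1 = 2\<close>; the value at \<open>0\<close> is irrelevant.\<close>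

definition kth_prime :: "nat \<Rightarrow> nat" where
  "kth_prime k = enumerate {p. prime p} (k - 1)"

end

theory Submission
  imports Defs
begin

text \<open>
  If \<open>g\<close> vanishes to order \<open>a\<close> at \<open>0\<close>, then \<open>\<bar>g y\<bar> \<le> K y ^ a\<close> on the whole interval \<open>[0, 1]\<close>, and this
  is sharp near \<open>0\<close>. For a fixed prime \<open>p\<close>, collecting the terms with \<open>n * l = m\<close> turns the double sum
  into \<open>\<Sum>m. c m / m * g (p powr - (s * m))\<close> with \<open>c m\<close> the sum of \<open>\<mu> n\<close> over the divisors \<open>n \<le> x\<close>
  of \<open>m\<close>. Here \<open>c 1 = 1\<close>, \<open>c m = 0\<close> for \<open>1 < m \<le> x\<close>, and \<open>\<bar>c m\<bar> \<le> x\<close> always, so that the error is a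
  geometric tail of size \<open>x * p powr - (s * a * (x + 1))\<close>. Summed over all primes this is dominated
  by the contribution of \<open>p = 2\<close>.
\<close>

section \<open>Divisor sums of the Moebius function\<close>

lemma prime_factors_prod_primes:
  fixes P :: "nat set"
  assumes "finite P" "\<And>p. p \<in> P \<Longrightarrow> prime p"
  shows "prime_factors (\<Prod>P) = P"
proof -
  have "prime_factors (\<Prod>P) = (\<Union>p\<in>P. prime_factors p)"
    using assms not_prime_0 by (subst prime_factors_prod) force+
  also have "\<dots> = P"
    using assms by (auto simp: prime_prime_factors)
  finally show ?thesis .
qed

lemma prod_primes_dvd:
  fixes P :: "nat set"
  assumes "finite P" "\<And>p. p \<in> P \<Longrightarrow> prime p" "\<And>p. p \<in> P \<Longrightarrow> p dvd m"
  shows "\<Prod>P dvd m"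
  using assms
proof (induction P rule: finite_induct)
  case (insert p P)
  have "coprime p (\<Prod>P)"
    using insert by (intro prod_coprime_right primes_coprime) auto
  then show ?case
    using insert by (auto intro!: divides_mult)
qed auto

text \<open>Expanding the product over \<open>F\<close> of the factors \<open>(- 1) + 1\<close>
  gives this sum, and at least one such factor is present.\<close>

lemma sum_minus_one_power_card_Pow:
  assumes "finite F" "F \<noteq> {}"
  shows "(\<Sum>P\<in>Pow F. (- 1) ^ card P) = (0 :: int)"
proof -
  have "(\<Sum>P\<in>Pow F. (- 1) ^ card P) = (\<Prod>x\<in>F. (- 1) + (1 :: int))"
    using assms(1) by (subst prod_add) auto
  then show ?thesis
    using assms by (simp add: card_gt_0_iff)
qed

text \<open>Divisors that are not products of distinct primes contribute 0. The others correspond to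
  the subsets of \<open>prime_factors m\<close>, so that an alternating sum over a power set
  remains.\<close>

lemma sum_moebius_mu_divisors:
  assumes "m > 0"
  shows "(\<Sum>d | d dvd m. moebius_mu d) = (if m = 1 then 1 else 0)"
proof -
  let ?F = "prime_factors m"
  have fin: "finite P" and prime: "p \<in> P \<Longrightarrow> prime p" and dvd: "p \<in> P \<Longrightarrow> p dvd m"
    if "P \<subseteq> ?F" for P p
    using that finite_subset by (auto simp: in_prime_factors_iff)
  have pf: "prime_factors (\<Prod>P) = P" if "P \<subseteq> ?F" for P
    using prime_factors_prod_primes fin[OF that] prime[OF that] by blast
  have inj: "inj_on Prod (Pow ?F)"
    by (rule inj_on_inverseI[of _ prime_factors]) (auto simp: pf)
  have "(\<Sum>d | d dvd m. moebius_mu d) = (\<Sum>d\<in>Prod ` Pow ?F. moebius_mu d)"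
  proof (rule sum.mono_neutral_right)
    show "finite {d. d dvd m}"
      using assms by simp
    show "Prod ` Pow ?F \<subseteq> {d. d dvd m}"
      using fin prime dvd by (auto intro!: prod_primes_dvd)
    show "\<forall>d\<in>{d. d dvd m} - Prod ` Pow ?F. moebius_mu d = 0"
    proof
      fix d assume d: "d \<in> {d. d dvd m} - Prod ` Pow ?F"
      then have "prime_factors d \<in> Pow ?F"
        using assms dvd_prime_factors[of m d] by auto
      then have "d \<noteq> \<Prod>(prime_factors d)"
        using d by auto
      then show "moebius_mu d = 0"
        by (simp add: moebius_mu_def)
    qed
  qed
  also have "\<dots> = (\<Sum>P\<in>Pow ?F. moebius_mu (\<Prod>P))"
    by (subst sum.reindex[OF inj]) (simp add: o_def)
  also have "\<dots> = (\<Sum>P\<in>Pow ?F. (- 1) ^ card P)"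
    by (intro sum.cong) (auto simp: moebius_mu_def pf)
  also have "\<dots> = (if m = 1 then 1 else 0)"
  proof (cases "m = 1")
    case False
    then have "?F \<noteq> {}"
      using assms by (auto simp: prime_factorization_empty_iff)
    then show ?thesis
      using False sum_minus_one_power_card_Pow[of ?F] by simp
  qed simp
  finally show ?thesis .
qed

lemma abs_moebius_mu_le_1: "\<bar>moebius_mu n\<bar> \<le> 1"
  by (simp add: moebius_mu_def power_abs)

section \<open>Truncated Moebius inversion for a single prime\<close>

text \<open>Intended use: \<open>f m\<close> is the value of \<open>g\<close> at
  \<open>p powr (- s * m)\<close> and \<open>r\<close> is \<open>p powr (- s * a)\<close>. As
  \<open>r \<le> 1 / 2\<close>, geometric series of ratio \<open>1 / 2\<close> dominate all tails,
  with constants independent of \<open>p\<close>.\<close>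

context
  fixes f :: "nat \<Rightarrow> complex" and K r :: real
  assumes K: "K \<ge> 0" and r: "0 \<le> r" "r \<le> 1 / 2"
    and f: "\<And>m. m \<ge> 1 \<Longrightarrow> norm (f m) \<le> K * r ^ m"
begin

lemma norm_multiples_term_le:
  assumes "n \<ge> 1"
  shows "norm (1 / of_nat (Suc l) * f (n * Suc l)) \<le> K * r ^ n * (1 / 2) ^ l"
proof -
  have "norm (1 / of_nat (Suc l) * f (n * Suc l)) = norm (f (n * Suc l)) / real (Suc l)"
    by (simp add: norm_divide norm_mult del: of_nat_Suc)
  also have "\<dots> \<le> norm (f (n * Suc l))"
    by (simp add: divide_le_eq mult_le_cancel_left1)
  also have "\<dots> \<le> K * r ^ (n * Suc l)"
    using assms by (intro f) simp
  \<comment> \<open>For \<open>n \<ge> 1\<close> one has \<open>n * Suc l \<ge> n + l\<close>, and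
    powers of \<open>r\<close> decrease.\<close>
  also have "\<dots> \<le> K * r ^ (n + l)"
    using assms r K by (intro mult_left_mono power_decreasing) auto
  also have "\<dots> \<le> K * (r ^ n * (1 / 2) ^ l)"
    unfolding power_add using K r by (intro mult_left_mono power_mono) auto
  finally show ?thesis
    by simp
qed

lemma summable_multiples:
  assumes "n \<ge> 1"
  shows "summable (\<lambda>l. 1 / of_nat (Suc l) * f (n * Suc l))"
  by (rule summable_comparison_test'[of "\<lambda>l. K * r ^ n * (1 / 2) ^ l" 0])
     (use norm_multiples_term_le[OF assms] in \<open>auto intro!: summable_mult summable_geometric\<close>)

lemma norm_suminf_multiples_le:
  assumes "n \<ge> 1"
  shows "norm (\<Sum>l. 1 / of_nat (Suc l) * f (n * Suc l)) \<le> 2 * K * r ^ n"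
proof -
  have "norm (\<Sum>l. 1 / of_nat (Suc l) * f (n * Suc l)) \<le> (\<Sum>l. K * r ^ n * (1 / 2) ^ l)"
    using norm_multiples_term_le[OF assms]
    by (intro norm_suminf_le summable_mult summable_geometric) auto
  also have "\<dots> = 2 * K * r ^ n"
    by (subst suminf_mult) (auto simp: suminf_geometric intro: summable_geometric)
  finally show ?thesis .
qed

text \<open>The sum over \<open>n\<close> is finite, so regrouping by \<open>m = n * Suc l\<close>
  amounts to adding finitely many convergent series termwise.\<close>

lemma norm_truncated_moebius_inversion_le:
  assumes x: "x \<ge> 1"
  shows "norm ((\<Sum>n=1..x. of_int (moebius_mu n) / of_nat n *
                 (\<Sum>l. 1 / of_nat (Suc l) * f (n * Suc l))) - f 1)
         \<le> 2 * K * real x * r ^ (x + 1)"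
proof -
  define c where "c m = (\<Sum>n\<in>{n\<in>{1..x}. n dvd m}. moebius_mu n)" for m
  define h where "h m = of_int (c m) * f m / of_nat m" for m
  \<comment> \<open>Each series is written over all \<open>m\<close>, with zeros off the multiples
    of \<open>n\<close>, so that all of them share one index; the weights combine to
    \<open>1 / m\<close>.\<close>
  have "(\<lambda>m. if n dvd m then of_int (moebius_mu n) * f m / of_nat m else 0) sums
        (of_int (moebius_mu n) / of_nat n * (\<Sum>l. 1 / of_nat (Suc l) * f (n * Suc l)))"
    (is "?F sums ?S") if "n \<in> {1..x}" for n
  proof -
    have "(\<lambda>l. of_int (moebius_mu n) / of_nat n * (1 / of_nat (Suc l) * f (n * Suc l))) sums ?S"
      using that summable_multiples by (intro sums_mult summable_sums) auto
    moreover have "(\<lambda>l. of_int (moebius_mu n) / of_nat n * (1 / of_nat (Suc l) * f (n * Suc l))) =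
                   (\<lambda>l. ?F (n * Suc l))"
      by (auto simp del: of_nat_Suc mult_Suc_right)
    ultimately have "(\<lambda>l. ?F (n * Suc l)) sums ?S"
      by simp
    moreover have "strict_mono (\<lambda>l. n * Suc l)"
      using that by (auto intro!: strict_monoI)
    \<comment> \<open>The index \<open>m = 0\<close> is divisible by \<open>n\<close> without being
      of the form \<open>n * Suc l\<close>; its term is a quotient by 0, hence 0.\<close>
    moreover have "?F m = 0" if m: "m \<notin> range (\<lambda>l. n * Suc l)" for m
    proof (cases "n dvd m")
      case True
      then obtain j where "m = n * j" ..
      with m have "m = 0"
        by (cases j) auto
      then show ?thesis
        by simp
    qed simp
    ultimately show ?thesis
      using sums_mono_reindex[of "\<lambda>l. n * Suc l" ?F] by blast
  qed
  then have "(\<lambda>m. \<Sum>n=1..x. if n dvd m then of_int (moebius_mu n) * f m / of_nat m else 0) sums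
     (\<Sum>n=1..x. of_int (moebius_mu n) / of_nat n * (\<Sum>l. 1 / of_nat (Suc l) * f (n * Suc l)))"
    (is "_ sums ?T") by (rule sums_sum)
  moreover have "(\<Sum>n=1..x. if n dvd m then of_int (moebius_mu n) * f m / of_nat m else 0) = h m" for m
    unfolding h_def c_def of_int_sum sum_distrib_right sum_divide_distrib
    by (rule sum.inter_filter[symmetric]) simp
  ultimately have h: "h sums ?T"
    by simp
  \<comment> \<open>In this range the truncation at \<open>x\<close> loses no divisor of
    \<open>m\<close>.\<close>
  have c_small: "c m = (if m = 1 then 1 else 0)" if "1 \<le> m" "m \<le> x" for m
  proof -
    have "{n\<in>{1..x}. n dvd m} = {n. n dvd m}"
      using that by (auto dest: dvd_imp_le intro: Suc_leI dvd_pos_nat)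
    then show ?thesis
      using that sum_moebius_mu_divisors[of m] by (simp add: c_def)
  qed
  have c_le: "\<bar>c m\<bar> \<le> int x" for m
  proof -
    have "\<bar>c m\<bar> \<le> (\<Sum>n\<in>{n\<in>{1..x}. n dvd m}. \<bar>moebius_mu n\<bar>)"
      unfolding c_def by (rule sum_abs)
    also have "\<dots> \<le> (\<Sum>n\<in>{n\<in>{1..x}. n dvd m}. 1)"
      by (intro sum_mono abs_moebius_mu_le_1)
    also have "\<dots> \<le> (\<Sum>n\<in>{1..x}. 1)"
      by (intro sum_mono2) auto
    finally show ?thesis
      by simp
  qed
  \<comment> \<open>Besides \<open>m = 1\<close> and the vanishing coefficients, the range contains
    \<open>m = 0\<close>, where \<open>h\<close> is 0 by division by 0.\<close>
  have "(\<Sum>m<x+1. h m) = (\<Sum>m\<in>{1}. h m)"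
    using x c_small by (intro sum.mono_neutral_right) (auto simp: h_def)
  also have "\<dots> = f 1"
    using x c_small[of 1] by (simp add: h_def)
  finally have "?T - f 1 = (\<Sum>m. h (m + (x + 1)))"
    using suminf_minus_initial_segment[of h "x + 1"] h by (simp add: sums_iff)
  \<comment> \<open>The coefficient \<open>c m / m\<close> is at most \<open>x\<close> in absolute
    value; \<open>r ^ m \<le> (1 / 2) ^ m\<close> is split off and sums to at most 2.\<close>
  also have "norm \<dots> \<le> (\<Sum>m. K * real x * r ^ (x + 1) * (1 / 2) ^ m)"
  proof (rule norm_suminf_le)
    show "norm (h (m + (x + 1))) \<le> K * real x * r ^ (x + 1) * (1 / 2) ^ m" for m
    proof -
      let ?m = "m + (x + 1)"
      have "norm (h ?m) = \<bar>real_of_int (c ?m)\<bar> * norm (f ?m) / real ?m"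
        by (simp add: h_def norm_divide norm_mult del: of_nat_Suc of_nat_add)
      also have "\<dots> \<le> \<bar>real_of_int (c ?m)\<bar> * norm (f ?m) / 1"
        by (intro divide_left_mono) auto
      also have "\<dots> = \<bar>real_of_int (c ?m)\<bar> * norm (f ?m)"
        by simp
      also have "\<dots> \<le> real x * (K * r ^ ?m)"
        using c_le[of ?m] by (intro mult_mono f) auto
      also have "\<dots> \<le> real x * (K * ((1 / 2) ^ m * r ^ (x + 1)))"
        unfolding power_add[of r m] using K r by (intro mult_left_mono mult_right_mono power_mono) auto
      finally show ?thesis
        by (simp add: mult_ac)
    qed
    show "summable (\<lambda>m. K * real x * r ^ (x + 1) * (1 / 2) ^ m)"
      by (intro summable_mult summable_geometric) auto
  qed
  also have "\<dots> = 2 * K * real x * r ^ (x + 1)"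
    by (subst suminf_mult) (auto simp: suminf_geometric intro: summable_geometric)
  finally show ?thesis .
qed

end

section \<open>Size of an analytic function vanishing at 0\<close>

text \<open>Unless \<open>g\<close> vanishes on the interval, \<open>g w = w ^ a * h w\<close> near
  0 with \<open>h\<close> free of zeros. Bounds for \<open>h\<close> and \<open>1 / h\<close> give
  both estimates near 0, and compactness extends the upper one to the interval. The lower one stays
  local, since \<open>g\<close> may have further zeros.\<close>

lemma zero_order_bounds:
  assumes g: "g analytic_on (complex_of_real ` {0..1})" and g0: "g 0 = 0"
  obtains K c :: real and a :: nat where "K \<ge> 0" "a \<ge> 1" "c > 0"
    "\<And>y. 0 \<le> y \<Longrightarrow> y \<le> 1 \<Longrightarrow> norm (g (of_real y)) \<le> K * y ^ a"
    "eventually (\<lambda>y. K * y ^ a \<le> c * norm (g (of_real y))) (at_right 0)"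
proof (cases "\<forall>y\<in>{0..1}. g (of_real y) = 0")
  case True
  then show ?thesis
    \<comment> \<open>With \<open>K = 0\<close> both estimates are trivial.\<close>
    using that[of 0 1 1] by simp
next
  case False
  then obtain y0 where y0: "y0 \<in> {0..1}" "g (of_real y0) \<noteq> 0"
    by blast
  let ?I = "complex_of_real ` {0..1}"
  obtain T where T: "open T" "?I \<subseteq> T" "g holomorphic_on T"
    using g by (auto simp: analytic_on_holomorphic)
  \<comment> \<open>The factorization requires a connected domain. The component of 0 contains the
    whole interval, hence \<open>y0\<close>, so \<open>g\<close> is not constant on it.\<close>
  define S where "S = connected_component_set T 0"
  have I: "connected ?I" "compact ?I"
    by (intro connected_continuous_image compact_continuous_image continuous_on_of_real
          continuous_on_id connected_Icc compact_Icc)+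
  have "0 \<in> ?I"
    by force
  then have IS: "?I \<subseteq> S"
    unfolding S_def using T I by (intro connected_component_maximal) auto
  have S: "open S" "connected S" "S \<subseteq> T"
    using T by (auto simp: S_def open_connected_component connected_component_subset)
  have nc: "\<not> g constant_on S"
    using y0 g0 \<open>0 \<in> ?I\<close> IS unfolding constant_on_def by (metis image_eqI subsetD)
  obtain h \<rho> a where h: "0 < a" "0 < \<rho>" "h holomorphic_on ball 0 \<rho>"
      "\<And>w. w \<in> ball 0 \<rho> \<Longrightarrow> g w = (w - 0) ^ a * h w" "\<And>w. w \<in> ball 0 \<rho> \<Longrightarrow> h w \<noteq> 0"
    by (rule holomorphic_factor_zero_nonconstant[OF holomorphic_on_subset[OF T(3) S(3)] S(1,2)
          subsetD[OF IS \<open>0 \<in> ?I\<close>] g0 nc]) blast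
  \<comment> \<open>Halving the radius gives a compact ball on which \<open>h\<close> and
    \<open>1 / h\<close> are bounded.\<close>
  let ?C = "cball (0 :: complex) (\<rho> / 2)"
  have C: "?C \<subseteq> ball 0 \<rho>"
    using h by auto
  have cont_h: "continuous_on ?C h"
    using h C holomorphic_on_imp_continuous_on continuous_on_subset by blast
  have cont_g: "continuous_on ?I g"
    using T holomorphic_on_imp_continuous_on continuous_on_subset by blast
  obtain B where B: "B > 0" "\<And>w. w \<in> ?C \<Longrightarrow> norm (h w) \<le> B"
    using compact_imp_bounded[OF compact_continuous_image[OF cont_h compact_cball]]
    by (auto simp: bounded_pos)
  obtain B' where B': "B' > 0" "\<And>w. w \<in> ?I \<Longrightarrow> norm (g w) \<le> B'"
    using compact_imp_bounded[OF compact_continuous_image[OF cont_g I(2)]]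
    by (auto simp: bounded_pos)
  have "continuous_on ?C (\<lambda>w. inverse (h w))"
    using cont_h h C by (intro continuous_on_inverse) auto
  then obtain D where D: "D > 0" "\<And>w. w \<in> ?C \<Longrightarrow> norm (inverse (h w)) \<le> D"
    using compact_imp_bounded[OF compact_continuous_image[OF _ compact_cball[of "0 :: complex" "\<rho> / 2"]],
      of "\<lambda>w. inverse (h w)"]
    by (auto simp: bounded_pos)
  \<comment> \<open>\<open>B\<close> serves for \<open>y \<le> \<rho> / 2\<close>; beyond that,
    \<open>2 / \<rho> * y \<ge> 1\<close> lets the global bound \<open>B'\<close> absorb the factor
    \<open>(2 / \<rho> * y) ^ a\<close>.\<close>
  define K where "K = max B (B' * (2 / \<rho>) ^ a)"
  have K: "K > 0"
    using B by (simp add: K_def)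
  show ?thesis
  proof (rule that[of K a "K * D"])
    show "norm (g (of_real y)) \<le> K * y ^ a" if y: "0 \<le> y" "y \<le> 1" for y
    proof (cases "y \<le> \<rho> / 2")
      case True
      then have "norm (g (of_real y)) = y ^ a * norm (h (of_real y))"
        using y h(4)[of "of_real y"] h(2) by (simp add: norm_mult norm_power)
      also have "\<dots> \<le> y ^ a * K"
        using True y B(2)[of "of_real y"] by (intro mult_left_mono) (auto simp: K_def)
      finally show ?thesis
        by (simp add: mult.commute)
    next
      case False
      then have "1 \<le> 2 / \<rho> * y"
        using h(2) by (simp add: field_simps)
      then have "B' * 1 \<le> B' * (2 / \<rho> * y) ^ a"
        using B' by (intro mult_left_mono one_le_power) auto
      also have "\<dots> = (B' * (2 / \<rho>) ^ a) * y ^ a"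
        by (simp add: power_mult_distrib power_divide)
      also have "\<dots> \<le> K * y ^ a"
        using y by (intro mult_right_mono) (auto simp: K_def)
      finally show ?thesis
        using B'(2)[of "of_real y"] y by force
    qed
    show "eventually (\<lambda>y. K * y ^ a \<le> K * D * norm (g (of_real y))) (at_right 0)"
      unfolding eventually_at_right_field
    proof (intro exI[of _ "\<rho> / 2"] conjI allI impI)
      fix y :: real assume y: "0 < y" "y < \<rho> / 2"
      have "norm (inverse (h (of_real y))) \<le> D" "h (of_real y) \<noteq> 0"
        using y D(2)[of "of_real y"] h(5)[of "of_real y"] by auto
      then have "1 \<le> D * norm (h (of_real y))"
        by (simp add: norm_inverse inverse_eq_divide norm_divide divide_le_eq)
      then have "K * y ^ a * 1 \<le> K * y ^ a * (D * norm (h (of_real y)))"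
        using K y by (intro mult_left_mono) auto
      also have "\<dots> = K * D * norm (g (of_real y))"
        using y h(4)[of "of_real y"] by (simp add: norm_mult norm_power mult_ac)
      finally show "K * y ^ a \<le> K * D * norm (g (of_real y))"
        by simp
    qed (use h in auto)
  qed (use K D h in auto)
qed

section \<open>Summation over the primes and the error term\<close>

lemma prime_kth_prime: "prime (kth_prime k)"
  using enumerate_in_set[OF primes_infinite] by (auto simp: kth_prime_def)

text \<open>As \<open>kth_prime (Suc k) \<ge> k\<close>, the series of \<open>k powr (- s)\<close>
  dominates. The comparison starts at \<open>k = 1\<close> because \<open>0 powr (- s)\<close> is
  0.\<close>

lemma summable_kth_prime_powr:
  assumes "s > 1"
  shows "summable (\<lambda>k. 1 / real (kth_prime (Suc k)) powr s)"
proof (rule summable_comparison_test')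
  show "summable (\<lambda>k. real k powr (- s))"
    using assms by (simp add: summable_real_powr_iff)
  show "norm (1 / real (kth_prime (Suc k)) powr s) \<le> real k powr (- s)" if "k \<ge> 1" for k
  proof -
    have "k \<le> kth_prime (Suc k)"
      using le_enumerate[OF primes_infinite, of k] by (simp add: kth_prime_def)
    then show ?thesis
      using that assms by (auto simp: powr_minus divide_simps intro!: powr_mono2)
  qed
qed

text \<open>The summability claims ensure that the infinite sums are genuine limits. The last claim
  makes the constant uniform in \<open>x\<close>, away from those \<open>x\<close> where
  \<open>g\<close> happens to vanish at the point that defines the bound.\<close>

theorem theorem3:
  fixes s :: real and g :: "complex \<Rightarrow> complex" and A :: "complex set"
  assumes s: "s > 1"
    and A: "complex_of_real ` {-1<..1} \<subseteq> A"
    and g: "g analytic_on A"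
    and g0: "g 0 = 0"
    and coeffs_real: "\<And>a. a \<ge> 1 \<Longrightarrow> (deriv ^^ a) g 0 / fact a \<in> \<real>"
    and coeffs_bdd: "bdd_above ((\<lambda>a. Re ((deriv ^^ a) g 0 / fact a)) ` {1..})"
  shows
    "let t = (\<lambda>n k l. 1 / of_nat l *
               g (of_real (1 / real (kth_prime k) powr (s * real n * real l))));
         main = (\<lambda>k. g (of_real (1 / real (kth_prime k) powr s)));
         err = (\<lambda>x. (\<Sum>n=1..x. of_int (moebius_mu n) / of_nat n * (\<Sum>k. \<Sum>l. t n (Suc k) (Suc l)))
                     - (\<Sum>k. main (Suc k)));
         bound = (\<lambda>x::nat. of_nat x * g (of_real (1 / 2 powr (s * (real x + 1)))))
     in (\<forall>n\<ge>1. (\<forall>k. summable (\<lambda>l. t n (Suc k) (Suc l))) \<and>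
                 summable (\<lambda>k. \<Sum>l. t n (Suc k) (Suc l))) \<and>
        summable (\<lambda>k. main (Suc k)) \<and>
        err \<in> O[sequentially](bound) \<and>
        (\<exists>C. \<forall>x>1. bound x \<noteq> 0 \<longrightarrow> norm (err x) \<le> C * norm (bound x))"
proof -
  have "complex_of_real ` {0..1} \<subseteq> complex_of_real ` {-1<..1}"
    by (intro image_mono) auto
  then have "g analytic_on complex_of_real ` {0..1}"
    using analytic_on_subset[OF g] A by (meson subset_trans)
  then obtain K c a where Kc: "K \<ge> 0" "a \<ge> 1" "c > 0"
    and upper: "\<And>y. 0 \<le> y \<Longrightarrow> y \<le> 1 \<Longrightarrow> norm (g (of_real y)) \<le> K * y ^ a"
    and lower: "eventually (\<lambda>y. K * y ^ a \<le> c * norm (g (of_real y))) (at_right 0)"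
    using g0 by (rule zero_order_bounds) blast

  \<comment> \<open>For \<open>p = kth_prime (Suc k)\<close>, \<open>q k\<close> is
    \<open>p powr (- s)\<close> and \<open>R n k\<close> is the inner series over \<open>l\<close>.
    Indices start at 0, so \<open>q 0\<close> belongs to the prime 2.\<close>
  define q where "q k = 1 / real (kth_prime (Suc k)) powr s" for k
  define f where "f k m = g (of_real (q k ^ m))" for k m
  define R where "R n k = (\<Sum>l. 1 / of_nat (Suc l) * f k (n * Suc l))" for n k
  define err where "err x = (\<Sum>n=1..x. of_int (moebius_mu n) / of_nat n * (\<Sum>k. R n k)) - (\<Sum>k. f k 1)"
    for x
  define y where "y x = 1 / 2 powr (s * (real x + 1))" for x
  define bound where "bound x = of_nat x * g (of_real (y x))" for x

  have p2: "real (kth_prime k) \<ge> 2" for k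
    using prime_ge_2_nat[OF prime_kth_prime[of k]] by simp
  have q_powr: "1 / real (kth_prime (Suc k)) powr (s * real n * real l) = q k ^ (n * l)" for k n l
    using p2[of "Suc k"] by (simp add: q_def power_one_over powr_realpow[symmetric] powr_powr mult_ac)
  have q_pos: "q k > 0" for k
    using p2[of "Suc k"] by (simp add: q_def)
  have q_le2: "q k \<le> 1 / 2 powr s" for k
    using p2[of "Suc k"] s by (auto simp: q_def intro!: divide_left_mono powr_mono2)
  have "2 powr 1 \<le> 2 powr s"
    using s by (intro powr_mono) auto
  then have s_half: "1 / 2 powr s \<le> 1 / 2"
    by (simp add: field_simps)
  have q_half: "q k \<le> 1 / 2" for k
    using q_le2[of k] s_half by linarith
  have qa: "0 \<le> q k ^ a" "q k ^ a \<le> 1 / 2" "q k ^ a \<le> q k" for k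
  proof -
    show "q k ^ a \<le> q k"
      using power_decreasing[of 1 a "q k"] Kc q_pos[of k] q_half[of k] by simp
    then show "q k ^ a \<le> 1 / 2"
      using q_half[of k] by linarith
  qed (use q_pos[of k] in simp)
  have q_summable: "summable q"
    unfolding q_def by (rule summable_kth_prime_powr[OF s])
  have f_le: "norm (f k m) \<le> K * (q k ^ a) ^ m" for k m
    using upper[of "q k ^ m"] q_pos[of k] q_half[of k]
    by (simp add: f_def power_le_one power_mult[symmetric] mult.commute)
  \<comment> \<open>These are the hypotheses of the single-prime estimates, with
    \<open>r = q k ^ a\<close>.\<close>
  note tail = Kc(1) qa(1,2) f_le

  have sum_l: "summable (\<lambda>l. 1 / of_nat (Suc l) * f k (n * Suc l))" if "n \<ge> 1" for n k
    using summable_multiples[OF tail that] .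
  have sum_k: "summable (R n)" if "n \<ge> 1" for n
  proof (rule summable_comparison_test')
    show "summable (\<lambda>k. 2 * K * q k)"
      by (intro summable_mult q_summable)
    show "norm (R n k) \<le> 2 * K * q k" if "k \<ge> 0" for k
    proof -
      have "norm (R n k) \<le> 2 * K * (q k ^ a) ^ n"
        unfolding R_def using norm_suminf_multiples_le[OF tail \<open>n \<ge> 1\<close>] .
      also have "(q k ^ a) ^ n \<le> q k ^ a"
        using power_decreasing[of 1 n "q k ^ a"] qa[of k] \<open>n \<ge> 1\<close> by simp
      also have "\<dots> \<le> q k"
        by (rule qa)
      finally show ?thesis
        using Kc by (simp add: mult_left_mono)
    qed
  qed
  have sum_main: "summable (\<lambda>k. f k 1)"
  proof (rule summable_comparison_test')
    show "summable (\<lambda>k. K * q k)"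
      by (intro summable_mult q_summable)
    show "norm (f k 1) \<le> K * q k" if "k \<ge> 0" for k
      using f_le[of k 1] mult_left_mono[OF qa(3)[of k] Kc(1)] by simp
  qed

  \<comment> \<open>\<open>Z\<close> is the sum of \<open>(2 / p) powr s\<close> over all primes
    \<open>p\<close>.\<close>
  define Z where "Z = 2 powr s * suminf q"
  have Z: "Z \<ge> 0"
    unfolding Z_def
    by (intro mult_nonneg_nonneg suminf_nonneg q_summable less_imp_le[OF q_pos]) simp
  have y_eq: "y x = (1 / 2 powr s) ^ (x + 1)" for x
    by (simp add: y_def power_one_over powr_realpow[symmetric] powr_powr powr_add algebra_simps)
  have err_le: "norm (err x) \<le> 2 * Z * real x * (K * y x ^ a)" if x: "x \<ge> 1" for x
  proof -
    have "(\<lambda>k. (\<Sum>n=1..x. of_int (moebius_mu n) / of_nat n * R n k) - f k 1) sums err x"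
      unfolding err_def using sum_k sum_main
      by (intro sums_diff sums_sum sums_mult summable_sums) auto
    then have "err x = (\<Sum>k. (\<Sum>n=1..x. of_int (moebius_mu n) / of_nat n * R n k) - f k 1)"
      by (simp add: sums_iff)
    also have "norm \<dots> \<le> (\<Sum>k. 2 * K * real x * y x ^ a * 2 powr s * q k)"
    proof (rule norm_suminf_le)
      show "norm ((\<Sum>n=1..x. of_int (moebius_mu n) / of_nat n * R n k) - f k 1)
            \<le> 2 * K * real x * y x ^ a * 2 powr s * q k" for k
      proof -
        \<comment> \<open>This is \<open>(2 / p) powr s\<close>, at most 1 because
          \<open>p \<ge> 2\<close>. One power of \<open>u\<close> is kept for summability over
          \<open>k\<close>; dropping the others makes the bound uniform in \<open>x\<close>.\<close>
        define u where "u = 2 powr s * q k"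
        have u: "0 \<le> u" "u \<le> 1" "q k = 1 / 2 powr s * u"
          using q_pos[of k] q_le2[of k] by (auto simp: u_def field_simps)
        have "(q k ^ a) ^ (x + 1) = y x ^ a * u ^ (a * (x + 1))"
          unfolding u(3) y_eq power_mult[symmetric] power_mult_distrib by (simp add: mult.commute)
        also have "u ^ (a * (x + 1)) \<le> u"
          using power_decreasing[of 1 "a * (x + 1)" u] u Kc by simp
        finally have *: "(q k ^ a) ^ (x + 1) \<le> y x ^ a * u"
          by (simp add: y_eq mult_left_mono)
        have "norm ((\<Sum>n=1..x. of_int (moebius_mu n) / of_nat n * R n k) - f k 1)
              \<le> 2 * K * real x * (q k ^ a) ^ (x + 1)"
          unfolding R_def using norm_truncated_moebius_inversion_le[OF tail x] .
        also have "\<dots> \<le> 2 * K * real x * (y x ^ a * u)"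
          using Kc by (intro mult_left_mono *) auto
        finally show ?thesis
          by (simp add: u_def mult_ac)
      qed
      show "summable (\<lambda>k. 2 * K * real x * y x ^ a * 2 powr s * q k)"
        by (intro summable_mult q_summable)
    qed
    also have "\<dots> = 2 * Z * real x * (K * y x ^ a)"
      by (simp add: suminf_mult[OF q_summable] Z_def)
    finally show ?thesis .
  qed

  \<comment> \<open>Since \<open>y x\<close> tends to 0 from above, the local lower bound for
    \<open>g\<close> eventually applies at \<open>y x\<close> and turns \<open>K * y x ^ a\<close>
    into a multiple of the norm of \<open>g\<close> there.\<close>
  have "filterlim y (at_right 0) sequentially"
  proof -
    have "(\<lambda>x. (1 / 2 powr s) ^ (x + 1)) \<longlonglongrightarrow> 0"
      using s_half by (intro LIMSEQ_ignore_initial_segment LIMSEQ_power_zero) auto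
    then show ?thesis
      by (auto simp: filterlim_at y_eq[abs_def])
  qed
  then have "eventually (\<lambda>x. K * y x ^ a \<le> c * norm (g (of_real (y x)))) sequentially"
    using lower filterlim_iff by blast
  then have "eventually (\<lambda>x. norm (err x) \<le> 2 * Z * c * norm (bound x)) sequentially"
    using eventually_ge_at_top[of 1]
  proof eventually_elim
    case (elim x)
    have "2 * Z * real x * (K * y x ^ a) \<le> 2 * Z * real x * (c * norm (g (of_real (y x))))"
      using Z elim by (intro mult_left_mono) auto
    then show ?case
      using err_le[of x] elim by (simp add: bound_def norm_mult mult_ac)
  qed
  then obtain N where N: "\<And>x. x \<ge> N \<Longrightarrow> norm (err x) \<le> 2 * Z * c * norm (bound x)"
    by (auto simp: eventually_at_top_linorder)
  then have bigo: "err \<in> O[sequentially](bound)"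
    by (intro bigoI[of _ "2 * Z * c"]) (auto simp: eventually_at_top_linorder)
  \<comment> \<open>The finitely many \<open>x < N\<close> are covered by adding their own ratios; a
    ratio with \<open>bound x = 0\<close> counts as 0.\<close>
  define C where "C = 2 * Z * c + (\<Sum>x<N. norm (err x) / norm (bound x))"
  have "norm (err x) \<le> C * norm (bound x)" if "bound x \<noteq> 0" for x
  proof (cases "x \<ge> N")
    case True
    have "norm (err x) \<le> 2 * Z * c * norm (bound x)"
      using N True .
    also have "\<dots> \<le> C * norm (bound x)"
      by (intro mult_right_mono) (auto simp: C_def intro!: sum_nonneg)
    finally show ?thesis .
  next
    case False
    then have "norm (err x) / norm (bound x) \<le> (\<Sum>x<N. norm (err x) / norm (bound x))"
      by (intro member_le_sum) auto
    also have "\<dots> \<le> C"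
      using Z Kc by (simp add: C_def)
    finally show ?thesis
      using that by (simp add: divide_le_eq)
  qed
  then have uniform: "\<exists>C. \<forall>x>1. bound x \<noteq> 0 \<longrightarrow> norm (err x) \<le> C * norm (bound x)"
    by blast

  have t_eq: "1 / of_nat (Suc l) * g (of_real (1 / real (kth_prime (Suc k)) powr (s * real n * real (Suc l))))
      = 1 / of_nat (Suc l) * f k (n * Suc l)" for n k l
    unfolding f_def q_powr ..
  have main_eq: "g (of_real (1 / real (kth_prime (Suc k)) powr s)) = f k 1" for k
    by (simp add: f_def q_def)
  show ?thesis
    unfolding Let_def t_eq main_eq R_def[symmetric] y_def[symmetric] bound_def[symmetric] err_def[symmetric]
    by (intro conjI allI impI sum_l sum_k sum_main bigo uniform)
qed

end
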